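(* Let $\mathbb{G}_2$ be the symmetrized bidisc, $\Gamma_2=\overline{\mathbb{G}_2}$ its closure, $b\Gamma_2$ its distinguished boundary, and $V(\mathbb{G}_2)=\{(s,p)\in\Gamma_2 : s^2=4p\}$. For $v\in \mathrm{Aut}(\mathbb{D})$ let $\tau_v:\Gamma_2\to\Gamma_2$ be the map $\tau_v(z_1+z_2,z_1z_2)=(v(z_1)+v(z_2),v(z_1)v(z_2))$ for $z_1,z_2\in\overline{\mathbb{D}}$. Then \[ b\Gamma_2=\{\tau_v(0,1),\ \tau_v(2,1) : v\in \mathrm{Aut}(\mathbb{D})\}. \] Furthermore, \[ b\Gamma_2\cap V(\mathbb{G}_2)=\{\tau_v(2,1) : v\in \mathrm{Aut}(\mathbb{D})\}\quad\text{and}\quad b\Gamma_2\setminus V(\mathbb{G}_2)=\{\tau_v(0,1) : v\in \mathrm{Aut}(\mathbb{D})\}. \]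
   Context: $\mathbb{D}$ is the open unit disc in $\mathbb{C}$ and $\mathbb{T}$ is the unit circle. $\mathrm{Aut}(\mathbb{D})$ is the group of biholomorphic self-maps of $\mathbb{D}$; its elements are exactly the maps $\omega B_\alpha$ with $\omega\in\mathbb{T}$, $\alpha\in\mathbb{D}$, where $B_\alpha(z)=\frac{z-\alpha}{\overline{\alpha}z-1}$, and each is regarded as extended by the same formula to $\overline{\mathbb{D}}$. The symmetrized bidisc is $\mathbb{G}_2=\{(z_1+z_2,z_1z_2)\in\mathbb{C}^2 : z_1,z_2\in\mathbb{D}\}$, with closure $\Gamma_2=\{(z_1+z_2,z_1z_2) : z_1,z_2\in\overline{\mathbb{D}}\}$. For a bounded domain $\Omega\subset\mathbb{C}^n$, $A(\Omega)$ is the algebra of continuous functions on $\overline{\Omega}$ that are holomorphic in $\Omega$. A boundary for $\Omega$ is a subset of $\overline{\Omega}$ on which every function in $A(\Omega)$ attains its maximum modulus; the distinguished boundary $b\overline{\Omega}$ is the smallest closed boundary. It is known (Agler and Young) that \[ b\Gamma_2=\{(s,p)\in\mathbb{C}^2 : |s|\le 2,\ s=\overline{s}p,\ |p|=1\}=\{(z_1+z_2,z_1z_2) : |z_1|=|z_2|=1\}. \] *)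

theory Defs
  imports "HOL-Complex_Analysis.Complex_Analysis"
begin

definition symmetrize :: "complex \<Rightarrow> complex \<Rightarrow> complex \<times> complex" where
  "symmetrize z1 z2 = (z1 + z2, z1 * z2)"

definition sym_bidisc :: "(complex \<times> complex) set" where
  "sym_bidisc = {symmetrize z1 z2 | z1 z2. z1 \<in> ball 0 1 \<and> z2 \<in> ball 0 1}"

definition Gamma2 :: "(complex \<times> complex) set" where
  "Gamma2 = closure sym_bidisc"

definition royal_variety :: "(complex \<times> complex) set" where
  "royal_variety = {(s, p). (s, p) \<in> Gamma2 \<and> s ^ 2 = 4 * p}"

text \<open>
  The library's \<^const>\<open>holomorphic_on\<close> covers one complex variable only. In two variables,
  holomorphy on an open set is Frechet differentiability with a complex-linear derivative;
  a \<^const>\<open>has_derivative\<close> derivative is already real-linear, so only compatibility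
  with complex scalars is added.
\<close>

definition holomorphic2_on :: "(complex \<times> complex \<Rightarrow> complex) \<Rightarrow> (complex \<times> complex) set \<Rightarrow> bool" where
  "holomorphic2_on f \<Omega> \<longleftrightarrow>
     (\<forall>x\<in>\<Omega>. \<exists>D. (f has_derivative D) (at x) \<and>
                 (\<forall>c s p. D (c * s, c * p) = c * D (s, p)))"

definition holo_algebra :: "(complex \<times> complex) set \<Rightarrow> (complex \<times> complex \<Rightarrow> complex) set" where
  "holo_algebra \<Omega> = {f. continuous_on (closure \<Omega>) f \<and> holomorphic2_on f \<Omega>}"

definition is_boundary :: "(complex \<times> complex) set \<Rightarrow> (complex \<times> complex) set \<Rightarrow> bool" where
  "is_boundary \<Omega> C \<longleftrightarrow> C \<subseteq> closure \<Omega> \<and>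
     (\<forall>f\<in>holo_algebra \<Omega>. \<exists>x\<in>C. \<forall>y\<in>closure \<Omega>. norm (f y) \<le> norm (f x))"

text \<open>The order on sets is inclusion, so \<open>LEAST\<close> picks the smallest closed boundary.\<close>

definition distinguished_boundary :: "(complex \<times> complex) set \<Rightarrow> (complex \<times> complex) set" where
  "distinguished_boundary \<Omega> = (LEAST C. closed C \<and> is_boundary \<Omega> C)"

text \<open>Only the values of an automorphism on the open disc matter; what the function does
  elsewhere is arbitrary, and the boundary values are supplied by \<open>aut_ext\<close>.\<close>

definition Aut_disc :: "(complex \<Rightarrow> complex) set" where
  "Aut_disc = {v. v holomorphic_on ball 0 1 \<and> bij_betw v (ball 0 1) (ball 0 1) \<and>
                  inv_into (ball 0 1) v holomorphic_on ball 0 1}"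

definition blaschke :: "complex \<Rightarrow> complex \<Rightarrow> complex" where
  "blaschke \<alpha> z = (z - \<alpha>) / (cnj \<alpha> * z - 1)"

text \<open>The extension of an automorphism to the closed disc by the same formula
  \<open>\<omega> * blaschke \<alpha> z\<close> that represents it on the open disc.\<close>

definition aut_ext :: "(complex \<Rightarrow> complex) \<Rightarrow> complex \<Rightarrow> complex" where
  "aut_ext v z = (THE w. \<exists>\<omega> \<alpha>. norm \<omega> = 1 \<and> norm \<alpha> < 1 \<and>
     (\<forall>u\<in>ball 0 1. v u = \<omega> * blaschke \<alpha> u) \<and> w = \<omega> * blaschke \<alpha> z)"

definition tau :: "(complex \<Rightarrow> complex) \<Rightarrow> complex \<times> complex \<Rightarrow> complex \<times> complex" where
  "tau v x = (THE y. \<exists>z1\<in>cball 0 1. \<exists>z2\<in>cball 0 1.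
     x = symmetrize z1 z2 \<and> y = symmetrize (aut_ext v z1) (aut_ext v z2))"

lemma symmetrize_eq_iff:
  "symmetrize a b = symmetrize c d \<longleftrightarrow> (a = c \<and> b = d) \<or> (a = d \<and> b = c)"
proof
  assume h: "symmetrize a b = symmetrize c d"
  then have s: "a + b = c + d" and p: "a * b = c * d" by (auto simp: symmetrize_def)
  have "(a - c) * (a - d) = a * a - a * (c + d) + c * d" by (simp add: algebra_simps)
  also have "\<dots> = 0" unfolding s[symmetric] p[symmetric] by (simp add: algebra_simps)
  finally have "a = c \<or> a = d" by simp
  then show "(a = c \<and> b = d) \<or> (a = d \<and> b = c)" using s by (auto simp: algebra_simps)
qed (auto simp: symmetrize_def algebra_simps)

lemma Gamma2_eq: "Gamma2 = {symmetrize z1 z2 | z1 z2. z1 \<in> cball 0 1 \<and> z2 \<in> cball 0 1}"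
proof -
  define g where "g = (\<lambda>x::complex \<times> complex. (fst x + snd x, fst x * snd x))"
  have g_image: "{symmetrize z1 z2 | z1 z2. z1 \<in> A \<and> z2 \<in> B} = g ` (A \<times> B)" for A B
    by (force simp: g_def symmetrize_def)
  have cont: "continuous_on S g" for S
    unfolding g_def by (intro continuous_intros)
  have cl: "closure (ball 0 1 \<times> ball 0 1) = cball (0::complex) 1 \<times> cball (0::complex) 1"
    by (simp add: closure_Times)
  have "compact (cball (0::complex) 1 \<times> cball (0::complex) 1)"
    by (intro compact_Times compact_cball)
  then have "closed (g ` (cball 0 1 \<times> cball 0 1))"
    by (intro compact_imp_closed compact_continuous_image cont)
  then have "closure (g ` (ball 0 1 \<times> ball 0 1)) \<subseteq> g ` (cball 0 1 \<times> cball 0 1)"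
    by (intro closure_minimal image_mono Sigma_mono ball_subset_cball)
  moreover have "g ` closure (ball 0 1 \<times> ball 0 1) \<subseteq> closure (g ` (ball 0 1 \<times> ball 0 1))"
    by (rule image_closure_subset[OF cont closed_closure closure_subset])
  ultimately have "closure (g ` (ball 0 1 \<times> ball 0 1)) = g ` (cball 0 1 \<times> cball 0 1)"
    unfolding cl by (rule antisym)
  then show ?thesis
    unfolding Gamma2_def sym_bidisc_def g_image .
qed

lemma tau_symmetrize:
  assumes "z1 \<in> cball 0 1" "z2 \<in> cball 0 1"
  shows "tau v (symmetrize z1 z2) = symmetrize (aut_ext v z1) (aut_ext v z2)"
  unfolding tau_def
proof (rule the_equality)
  show "\<exists>w1\<in>cball 0 1. \<exists>w2\<in>cball 0 1. symmetrize z1 z2 = symmetrize w1 w2 \<and>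
     symmetrize (aut_ext v z1) (aut_ext v z2) = symmetrize (aut_ext v w1) (aut_ext v w2)"
    using assms by blast
qed (auto simp: symmetrize_eq_iff)

lemma blaschke_unique:
  assumes "norm \<alpha> < 1" "norm \<omega> = 1" "norm \<beta> < 1" "norm \<eta> = 1"
    and eq: "\<And>u. u \<in> ball 0 1 \<Longrightarrow> \<omega> * blaschke \<alpha> u = \<eta> * blaschke \<beta> u"
  shows "\<omega> = \<eta> \<and> \<alpha> = \<beta>"
proof -
  have nz: "cnj c * u - 1 \<noteq> 0" if "norm c < 1" "norm u < 1" for c u :: complex
  proof
    assume "cnj c * u - 1 = 0"
    then have "norm c * norm u = 1"
      by (metis complex_mod_cnj eq_iff_diff_eq_0 norm_mult norm_one)
    moreover have "norm c * norm u < 1"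
      using mult_strict_mono'[of "norm c" 1 "norm u" 1] that by simp
    ultimately show False by simp
  qed
  have "\<omega> \<noteq> 0" "\<eta> \<noteq> 0" using assms by auto
  have "\<eta> * blaschke \<beta> \<alpha> = 0"
    using eq[of \<alpha>] assms(1) by (simp add: blaschke_def)
  then have ab: "\<alpha> = \<beta>"
    using \<open>\<eta> \<noteq> 0\<close> nz[of \<beta> \<alpha>] assms by (simp add: blaschke_def)
  obtain u where u: "u \<in> ball 0 1" "u \<noteq> \<alpha>"
  proof (cases "\<alpha> = 0")
    case True
    then show ?thesis using that[of "1/2"] by simp
  next
    case False
    then show ?thesis using that[of 0] by simp
  qed
  then have "blaschke \<alpha> u \<noteq> 0" using nz[of \<alpha> u] assms by (simp add: blaschke_def)
  then show ?thesis using eq[OF u(1)] ab by simp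
qed

lemma aut_ext_eq:
  assumes "norm \<omega> = 1" "norm \<alpha> < 1" "\<And>u. u \<in> ball 0 1 \<Longrightarrow> v u = \<omega> * blaschke \<alpha> u"
  shows "aut_ext v z = \<omega> * blaschke \<alpha> z"
  unfolding aut_ext_def
proof (rule the_equality)
  fix w
  assume "\<exists>\<omega>' \<alpha>'. norm \<omega>' = 1 \<and> norm \<alpha>' < 1 \<and>
     (\<forall>u\<in>ball 0 1. v u = \<omega>' * blaschke \<alpha>' u) \<and> w = \<omega>' * blaschke \<alpha>' z"
  then obtain \<omega>' \<alpha>' where *: "norm \<omega>' = 1" "norm \<alpha>' < 1"
    "\<forall>u\<in>ball 0 1. v u = \<omega>' * blaschke \<alpha>' u" "w = \<omega>' * blaschke \<alpha>' z" by blast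
  have "\<omega>' = \<omega> \<and> \<alpha>' = \<alpha>"
    by (rule blaschke_unique) (use * assms in auto)
  then show "w = \<omega> * blaschke \<alpha> z" using * by simp
qed (use assms in blast)

end

theory Submission
  imports Defs
begin

text \<open>
  Every function of \<open>A(G\<^sub>2)\<close> lifts to a symmetric function on the bidisc, so
  the one-variable maximum principle, applied in each variable on slightly smaller discs, shows
  that the symmetrized torus is a boundary. Conversely each of its points \<open>(s\<^sub>0, p\<^sub>0)\<close>
  lies in every boundary because it is the unique peak point of an explicit polynomial: as
  \<open>s = cnj s * p\<close> on the torus, the polynomial
  \<open>(s - s\<^sub>0) * (s - s\<^sub>0 * cnj p\<^sub>0 * p)\<close> equals
  \<open>p * (cmod (s - s\<^sub>0))\<^sup>2\<close> there. The orbits are computed with Schwarz's lemma: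
  since \<open>(2, 1)\<close> comes from \<open>(1, 1)\<close> and \<open>(0, 1)\<close> from \<open>(\<i>, -\<i>)\<close>,
  one needs that automorphisms of the disc act transitively on the circle and can carry
  \<open>(\<i>, -\<i>)\<close> to any pair of distinct points of the circle.
\<close>

section \<open>The maximum principle on the symmetrized bidisc\<close>

lemma continuous_on_symmetrize [continuous_intros]:
  assumes "continuous_on S f" "continuous_on S g"
  shows "continuous_on S (\<lambda>x. symmetrize (f x) (g x))"
  unfolding symmetrize_def by (intro continuous_intros assms)

lemma symmetrize_commute: "symmetrize a b = symmetrize b a"
  by (simp add: symmetrize_eq_iff)

lemma closure_sym_bidisc: "closure sym_bidisc = Gamma2"
  by (simp add: Gamma2_def)

lemma symmetrize_in_Gamma2: "norm a \<le> 1 \<Longrightarrow> norm b \<le> 1 \<Longrightarrow> symmetrize a b \<in> Gamma2"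
  by (auto simp: Gamma2_eq)

text \<open>The slice moves in the direction \<open>(r, r * w)\<close>, so complex linearity of
  \<open>D\<close> turns the chain rule into an ordinary complex derivative
  \<open>D (r, r * w)\<close>. One-variable theory then applies to each slice.\<close>

lemma holomorphic_on_slice:
  assumes f: "holomorphic2_on f sym_bidisc" and r: "norm r \<le> 1" and w: "norm w < 1"
  shows "(\<lambda>z. f (symmetrize (r * z) w)) holomorphic_on ball 0 1"
  unfolding holomorphic_on_def
proof
  fix z :: complex assume "z \<in> ball 0 1"
  then have "norm (r * z) < 1"
    using r mult_le_less_imp_less[of "norm r" 1 "norm z" 1]
    by (cases "r = 0") (auto simp: norm_mult)
  then have "symmetrize (r * z) w \<in> sym_bidisc"
    using w by (auto simp: sym_bidisc_def)
  then obtain D where D: "(f has_derivative D) (at (symmetrize (r * z) w))"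
    and lin: "\<And>c s p. D (c * s, c * p) = c * D (s, p)"
    using f unfolding holomorphic2_on_def by blast
  have "((\<lambda>z. symmetrize (r * z) w) has_derivative (\<lambda>h. (h * r, h * (r * w)))) (at z)"
    unfolding symmetrize_def by (auto intro!: derivative_eq_intros simp: algebra_simps)
  from diff_chain_at[OF this D]
  have "((\<lambda>z. f (symmetrize (r * z) w)) has_derivative (\<lambda>h. D (r, r * w) * h)) (at z)"
    by (simp add: o_def lin mult.commute)
  then have "((\<lambda>z. f (symmetrize (r * z) w)) has_field_derivative D (r, r * w)) (at z)"
    by (simp add: has_field_derivative_def)
  then show "(\<lambda>z. f (symmetrize (r * z) w)) field_differentiable at z within ball 0 1"
    using field_differentiable_def field_differentiable_at_within by blast
qed

lemma continuous_on_symmetrize_slice: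
  assumes "continuous_on Gamma2 f" "norm r \<le> 1" "norm w \<le> 1"
  shows "continuous_on (cball 0 1) (\<lambda>z. f (symmetrize (r * z) w))"
  by (rule continuous_on_compose2[OF assms(1)])
     (use assms(2,3) in \<open>auto intro!: continuous_intros symmetrize_in_Gamma2
        simp: norm_mult mult_le_one\<close>)

lemma maximum_principle_symmetrize_scaled:
  assumes f: "f \<in> holo_algebra sym_bidisc" and r: "norm r < 1"
    and B: "\<And>a b. norm a = 1 \<Longrightarrow> norm b = 1 \<Longrightarrow> norm (f (symmetrize (r * a) (r * b))) \<le> B"
    and z: "norm z \<le> 1" and w: "norm w \<le> 1"
  shows "norm (f (symmetrize (r * z) (r * w))) \<le> B"
proof -
  have cont: "continuous_on Gamma2 f" and hol: "holomorphic2_on f sym_bidisc"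
    using f by (auto simp: holo_algebra_def closure_sym_bidisc)
  have slice: "norm (f (symmetrize (r * z) (r * w))) \<le> B"
    if "norm z \<le> 1" "norm w \<le> 1" "\<And>a. norm a = 1 \<Longrightarrow> norm (f (symmetrize (r * a) (r * w))) \<le> B"
    for z w
  proof -
    have rw: "norm (r * w) < 1"
      using that(2) r mult_left_le[of "norm w" "norm r"] by (simp add: norm_mult)
    show ?thesis
    proof (rule maximum_modulus_frontier[where S = "cball 0 1" and \<xi> = z
          and f = "\<lambda>z. f (symmetrize (r * z) (r * w))"])
      show "(\<lambda>z. f (symmetrize (r * z) (r * w))) holomorphic_on interior (cball 0 1)"
        using holomorphic_on_slice[OF hol _ rw] r by simp
      show "continuous_on (closure (cball 0 1)) (\<lambda>z. f (symmetrize (r * z) (r * w)))"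
        using continuous_on_symmetrize_slice[OF cont, of r "r * w"] r rw by simp
    qed (use that in \<open>auto simp: frontier_cball\<close>)
  qed
  \<comment> \<open>The first use moves \<open>z\<close> to a circle point \<open>a\<close>; after
    swapping the arguments, the second moves \<open>w\<close> to the circle with \<open>a\<close>
    frozen.\<close>
  show ?thesis
    using slice[OF z w] slice[OF w] B by (metis order_refl symmetrize_commute)
qed

text \<open>The scaled version is used with r near 1. Uniform continuity of the lift on the closed
  bidisc lets one radius serve all points. Each passage between a point and its scaled copy costs
  e/2: once on the torus, once at \<open>y\<close>.\<close>

lemma maximum_principle_symmetrize:
  assumes f: "f \<in> holo_algebra sym_bidisc"
    and B: "\<And>a b. norm a = 1 \<Longrightarrow> norm b = 1 \<Longrightarrow> norm (f (symmetrize a b)) \<le> B"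
    and y: "y \<in> Gamma2"
  shows "norm (f y) \<le> B"
proof (rule field_le_epsilon)
  fix e :: real assume e: "e > 0"
  obtain z w where zw: "norm z \<le> 1" "norm w \<le> 1" "y = symmetrize z w"
    using y by (auto simp: Gamma2_eq)
  let ?K = "cball (0::complex) 1 \<times> cball (0::complex) 1"
  let ?F = "\<lambda>x. f (symmetrize (fst x) (snd x))"
  have "continuous_on Gamma2 f"
    using f by (simp add: holo_algebra_def closure_sym_bidisc)
  then have "continuous_on ?K ?F"
    by (rule continuous_on_compose2)
       (auto intro!: continuous_intros symmetrize_in_Gamma2)
  then have "uniformly_continuous_on ?K ?F"
    by (intro compact_uniformly_continuous compact_Times compact_cball)
  then obtain d where d: "d > 0"
    and ud: "\<And>x x'. x \<in> ?K \<Longrightarrow> x' \<in> ?K \<Longrightarrow> dist x' x < d \<Longrightarrow> dist (?F x') (?F x) < e / 2"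
    unfolding uniformly_continuous_on_def using e by (metis half_gt_zero)
  \<comment> \<open>Scaling moves each coordinate by at most d/3, hence the pair by at most 2d/3 <
    d. The cap 1/2 keeps \<open>t\<close> positive.\<close>
  define t where "t = 1 - min (1/2) (d / 3)"
  have t: "0 < t" "t < 1" "1 - t \<le> d / 3"
    using d by (auto simp: t_def min_def)
  define r where "r = complex_of_real t"
  have r: "norm r < 1" using t by (simp add: r_def)
  have close: "dist (f (symmetrize (r * a) (r * b))) (f (symmetrize a b)) < e / 2"
    if "norm a \<le> 1" "norm b \<le> 1" for a b
  proof -
    have near: "norm (r * c - c) \<le> d / 3" if "norm c \<le> 1" for c
    proof -
      have "norm (r * c - c) = norm (complex_of_real (t - 1) * c)"
        by (simp add: r_def algebra_simps)
      also have "\<dots> = (1 - t) * norm c"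
        using t(2) by (simp only: norm_mult norm_of_real abs_minus_commute[of t 1] abs_of_nonneg diff_ge_0_iff_ge less_imp_le)
      also have "\<dots> \<le> 1 - t" using that t by (simp add: mult_left_le)
      finally show ?thesis using t by simp
    qed
    have "dist (r * a, r * b) (a, b) \<le> norm (r * a - a) + norm (r * b - b)"
      unfolding dist_Pair_Pair dist_norm[of "r * a"] dist_norm[of "r * b"]
      by (rule sqrt_sum_squares_le_sum) auto
    then have "dist (r * a, r * b) (a, b) < d"
      using near[OF that(1)] near[OF that(2)] d by linarith
    moreover have "(r * a, r * b) \<in> ?K"
      using r that by (auto simp: norm_mult mult_le_one)
    ultimately show ?thesis
      using ud[of "(a, b)" "(r * a, r * b)"] that by simp
  qed
  have "norm (f (symmetrize (r * z) (r * w))) \<le> B + e / 2"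
  proof (rule maximum_principle_symmetrize_scaled[OF f r])
    fix a b :: complex assume "norm a = 1" "norm b = 1"
    then show "norm (f (symmetrize (r * a) (r * b))) \<le> B + e / 2"
      using close[of a b] B[of a b]
        norm_triangle_sub[of "f (symmetrize (r * a) (r * b))" "f (symmetrize a b)"]
      by (simp add: dist_norm)
  qed (use zw in auto)
  then show "norm (f y) \<le> B + e"
    using close[OF zw(1,2)] zw(3)
      norm_triangle_sub[of "f (symmetrize z w)" "f (symmetrize (r * z) (r * w))"]
    by (simp add: dist_norm norm_minus_commute)
qed

section \<open>Peak polynomials and the distinguished boundary\<close>

definition sym_torus :: "(complex \<times> complex) set" where
  "sym_torus = {symmetrize a b | a b. norm a = 1 \<and> norm b = 1}"

lemma sym_torus_subset_Gamma2: "sym_torus \<subseteq> Gamma2"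
  by (auto simp: sym_torus_def symmetrize_in_Gamma2)

lemma compact_sym_torus: "compact sym_torus"
proof -
  have "sym_torus = (\<lambda>x. symmetrize (fst x) (snd x)) ` (sphere 0 1 \<times> sphere 0 1)"
    by (force simp: sym_torus_def)
  also have "compact \<dots>"
    by (intro compact_continuous_image compact_Times compact_sphere continuous_intros)
  finally show ?thesis .
qed

text \<open>For unimodular \<open>a\<close>, \<open>b\<close> with product \<open>p\<close>,
  \<open>cnj a * p = b\<close> and \<open>cnj b * p = a\<close>; so \<open>cnj s * p\<close> only
  swaps the two summands of \<open>s\<close>.\<close>

lemma sym_torusD:
  assumes "(s, p) \<in> sym_torus"
  shows "norm p = 1" "cnj p * p = 1" "norm s \<le> 2" "s = cnj s * p"
proof -
  obtain a b where ab: "norm a = 1" "norm b = 1" "s = a + b" "p = a * b"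
    using assms by (auto simp: sym_torus_def symmetrize_def)
  have unit: "cnj a * a = 1" "cnj b * b = 1"
    using ab by (metis complex_norm_square mult.commute of_real_1 power_one)+
  show "norm p = 1" using ab by (simp add: norm_mult)
  show "cnj p * p = 1" using unit ab by (simp add: algebra_simps)
  show "norm s \<le> 2" using ab norm_triangle_ineq[of a b] by simp
  have "cnj s * p = (cnj a * a) * b + (cnj b * b) * a"
    using ab by (simp add: algebra_simps)
  then show "s = cnj s * p" using unit ab by simp
qed

text \<open>Compactness gives a maximum point on the torus, and the maximum principle extends its
  bound to all of \<open>Gamma2\<close>.\<close>

lemma is_boundary_sym_torus: "is_boundary sym_bidisc sym_torus"
  unfolding is_boundary_def closure_sym_bidisc
proof (intro conjI ballI sym_torus_subset_Gamma2)
  fix f assume f: "f \<in> holo_algebra sym_bidisc"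
  then have "continuous_on sym_torus (\<lambda>x. norm (f x))"
    by (auto simp: holo_algebra_def closure_sym_bidisc
      intro!: continuous_intros continuous_on_subset[OF _ sym_torus_subset_Gamma2])
  moreover have "symmetrize 1 1 \<in> sym_torus"
    unfolding sym_torus_def using norm_one by blast
  ultimately obtain x where x: "x \<in> sym_torus" "\<forall>y\<in>sym_torus. norm (f y) \<le> norm (f x)"
    using continuous_attains_sup[OF compact_sym_torus] by blast
  have "\<forall>y\<in>Gamma2. norm (f y) \<le> norm (f x)"
    using maximum_principle_symmetrize[OF f, of "norm (f x)"] x(2) unfolding sym_torus_def by blast
  with x(1) show "\<exists>x\<in>sym_torus. \<forall>y\<in>Gamma2. norm (f y) \<le> norm (f x)" by blast
qed

section \<open>Polynomials in s and p as members of the algebra\<close>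

lemma holomorphic2_on_const: "holomorphic2_on (\<lambda>x. c) S"
  unfolding holomorphic2_on_def
  by (intro ballI exI[of _ "\<lambda>h. 0"]) auto

lemma holomorphic2_on_fst: "holomorphic2_on fst S"
  unfolding holomorphic2_on_def
  by (intro ballI exI[of _ fst]) (auto intro: derivative_eq_intros)

lemma holomorphic2_on_snd: "holomorphic2_on snd S"
  unfolding holomorphic2_on_def
  by (intro ballI exI[of _ snd]) (auto intro: derivative_eq_intros)

lemma holomorphic2_on_add:
  assumes "holomorphic2_on f S" "holomorphic2_on g S"
  shows "holomorphic2_on (\<lambda>x. f x + g x) S"
  unfolding holomorphic2_on_def
proof
  fix x assume "x \<in> S"
  with assms obtain D E where "(f has_derivative D) (at x)" "\<And>c s p. D (c * s, c * p) = c * D (s, p)"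
    "(g has_derivative E) (at x)" "\<And>c s p. E (c * s, c * p) = c * E (s, p)"
    unfolding holomorphic2_on_def by meson
  then show "\<exists>D. ((\<lambda>x. f x + g x) has_derivative D) (at x) \<and>
      (\<forall>c s p. D (c * s, c * p) = c * D (s, p))"
    by (intro exI[of _ "\<lambda>h. D h + E h"]) (auto intro: has_derivative_add simp: algebra_simps)
qed

lemma holomorphic2_on_mult:
  assumes "holomorphic2_on f S" "holomorphic2_on g S"
  shows "holomorphic2_on (\<lambda>x. f x * g x) S"
  unfolding holomorphic2_on_def
proof
  fix x assume "x \<in> S"
  with assms obtain D E where "(f has_derivative D) (at x)" "\<And>c s p. D (c * s, c * p) = c * D (s, p)"
    "(g has_derivative E) (at x)" "\<And>c s p. E (c * s, c * p) = c * E (s, p)"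
    unfolding holomorphic2_on_def by meson
  then show "\<exists>D. ((\<lambda>x. f x * g x) has_derivative D) (at x) \<and>
      (\<forall>c s p. D (c * s, c * p) = c * D (s, p))"
    by (intro exI[of _ "\<lambda>h. f x * E h + D h * g x"] conjI has_derivative_mult)
       (simp_all add: algebra_simps)
qed

lemma holomorphic2_on_diff:
  assumes "holomorphic2_on f S" "holomorphic2_on g S"
  shows "holomorphic2_on (\<lambda>x. f x - g x) S"
  using holomorphic2_on_add[OF assms(1) holomorphic2_on_mult[OF holomorphic2_on_const assms(2)],
      of "-1"] by simp

lemmas holomorphic2_intros = holomorphic2_on_const holomorphic2_on_fst holomorphic2_on_snd
  holomorphic2_on_add holomorphic2_on_mult holomorphic2_on_diff

text \<open>On the torus this equals \<open>p * (16 - (norm (s - s0))\<^sup>2)\<close>. The constant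
  16 is (2 + 2)^2, a bound for |s - s0|^2 there, so the modulus is largest exactly where s =
  s0.\<close>

definition peak_factor :: "complex \<Rightarrow> complex \<Rightarrow> complex \<times> complex \<Rightarrow> complex" where
  "peak_factor s0 p0 x = 16 * snd x - (fst x - s0) * (fst x - s0 * cnj p0 * snd x)"

lemma peak_factor_in_holo_algebra: "peak_factor s0 p0 \<in> holo_algebra S"
  unfolding holo_algebra_def peak_factor_def[abs_def] mem_Collect_eq
  by (intro conjI continuous_intros holomorphic2_intros)

text \<open>When s0 = 0, \<open>peak_factor\<close> has modulus 16 at every torus point with s = 0,
  whatever p is. The extra factor, of modulus at most 2 on \<open>Gamma2\<close> when |p0| = 1,
  singles out p = p0.\<close>

lemma peak_in_holo_algebra: "(\<lambda>x. (1 + cnj p0 * snd x) * peak_factor s0 p0 x) \<in> holo_algebra S"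
proof -
  have "continuous_on (closure S) (peak_factor s0 p0)" "holomorphic2_on (peak_factor s0 p0) S"
    using peak_factor_in_holo_algebra[of s0 p0 S] by (simp_all add: holo_algebra_def)
  then show ?thesis
    unfolding holo_algebra_def mem_Collect_eq
    by (intro conjI continuous_intros holomorphic2_intros)
qed

lemma norm_peak_factor_sym_torus:
  assumes sp0: "(s0, p0) \<in> sym_torus" and sp: "(s, p) \<in> sym_torus"
  shows "norm (peak_factor s0 p0 (s, p)) = 16 - (norm (s - s0))\<^sup>2"
proof -
  note 0 = sym_torusD[OF sp0] and 1 = sym_torusD[OF sp]
  have s0: "s0 * cnj p0 = cnj s0"
    using 0(2,4) by (metis mult.assoc mult.commute mult.right_neutral)
  \<comment> \<open>The relation s = \<open>cnj s * p\<close>, used at both points, makes the second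
    factor p times the conjugate of the first.\<close>
  have "s - s0 * cnj p0 * p = cnj s * p - cnj s0 * p"
    using 1(4) s0 by argo
  also have "\<dots> = p * cnj (s - s0)" by (simp add: algebra_simps)
  finally have "peak_factor s0 p0 (s, p) = 16 * p - (s - s0) * (p * cnj (s - s0))"
    by (simp only: peak_factor_def fst_conv snd_conv)
  also have "\<dots> = p * (16 - (s - s0) * cnj (s - s0))" by (simp add: algebra_simps)
  also have "\<dots> = p * complex_of_real (16 - (norm (s - s0))\<^sup>2)"
    by (simp only: complex_norm_square[symmetric]) simp
  finally have "norm (peak_factor s0 p0 (s, p)) = \<bar>16 - (norm (s - s0))\<^sup>2\<bar>"
    using 1(1) by (simp only: norm_mult norm_of_real mult_1_left)
  moreover have "norm (s - s0) \<le> 4"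
    using norm_triangle_ineq4[of s s0] 0(3) 1(3) by linarith
  then have "(norm (s - s0))\<^sup>2 \<le> 4\<^sup>2" by (intro power_mono) auto
  ultimately show ?thesis by simp
qed

lemma norm_peak_factor_le:
  assumes "(s0, p0) \<in> sym_torus" "x \<in> Gamma2"
  shows "norm (peak_factor s0 p0 x) \<le> 16"
proof (rule maximum_principle_symmetrize[OF peak_factor_in_holo_algebra _ assms(2)])
  fix a b :: complex assume "norm a = 1" "norm b = 1"
  then have "symmetrize a b \<in> sym_torus" by (auto simp: sym_torus_def)
  then show "norm (peak_factor s0 p0 (symmetrize a b)) \<le> 16"
    using norm_peak_factor_sym_torus[OF assms(1), of "fst (symmetrize a b)" "snd (symmetrize a b)"]
    by simp
qed

text \<open>Expanding |1 + z|^2 = 1 + 2 Re z + |z|^2 \<ge> 4 with |z| \<le> 1 forces Re z \<ge>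
  1.\<close>

lemma norm_add_eq_2_imp_eq_1:
  assumes "norm z \<le> 1" "norm (1 + z) \<ge> 2"
  shows "z = (1::complex)"
proof -
  have "norm (1 + z)^2 \<ge> 2^2" "norm z^2 \<le> 1" using assms by (intro power_mono, auto simp: power_le_one)
  then have "Re z \<ge> 1" by (simp add: cmod_power2) (simp add: power2_eq_square algebra_simps)
  moreover have "Re z \<le> 1" using assms(1) complex_Re_le_cmod[of z] by linarith
  ultimately have "Re z = 1" by simp
  with \<open>norm z^2 \<le> 1\<close> show ?thesis by (simp add: cmod_power2 complex_eq_iff)
qed

text \<open>Two moduli that are at most 1 can have product 1 only if both equal 1.\<close>

lemma sym_torusI:
  assumes "(s, p) \<in> Gamma2" "norm p = 1"
  shows "(s, p) \<in> sym_torus"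
proof -
  obtain a b where ab: "norm a \<le> 1" "norm b \<le> 1" "(s, p) = symmetrize a b"
    using assms(1) by (auto simp: Gamma2_eq)
  then have "norm a * norm b = 1" using assms(2) by (auto simp: symmetrize_def norm_mult)
  then have "norm a = 1 \<and> norm b = 1"
    using ab mult_left_le[of "norm b" "norm a"] mult_left_le[of "norm a" "norm b"]
    by (auto simp: mult.commute)
  then show ?thesis using ab by (auto simp: sym_torus_def)
qed

text \<open>The factors are bounded by 2 and 16, so a product of at least 32 makes both extremal.
  The first then gives p = p0, which puts x on the torus; there the explicit modulus of the second
  gives s = s0.\<close>

lemma peak_unique:
  assumes sp0: "(s0, p0) \<in> sym_torus" and x: "x \<in> Gamma2"
    and ge: "norm ((1 + cnj p0 * snd x) * peak_factor s0 p0 x) \<ge> 32"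
  shows "x = (s0, p0)"
proof -
  obtain s p where sp: "x = (s, p)" by fastforce
  note 0 = sym_torusD[OF sp0]
  obtain a b where "norm a \<le> 1" "norm b \<le> 1" "x = symmetrize a b"
    using x by (auto simp: Gamma2_eq)
  then have "norm p \<le> 1" using sp by (auto simp: symmetrize_def norm_mult mult_le_one)
  then have le1: "norm (cnj p0 * p) \<le> 1" using 0 by (simp add: norm_mult)
  have le16: "norm (peak_factor s0 p0 x) \<le> 16" by (rule norm_peak_factor_le[OF sp0 x])
  have le2: "norm (1 + cnj p0 * p) \<le> 2" using le1 norm_triangle_ineq[of 1 "cnj p0 * p"] by simp
  have prod: "32 \<le> norm (1 + cnj p0 * p) * norm (peak_factor s0 p0 x)"
    using ge sp by (simp add: norm_mult)
  have "norm (1 + cnj p0 * p) \<ge> 2"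
    using prod mult_left_mono[OF le16, of "norm (1 + cnj p0 * p)"] by simp
  then have "cnj p0 * p = 1" by (rule norm_add_eq_2_imp_eq_1[OF le1])
  then have p: "p = p0" using 0(2) by (metis mult_cancel_left mult_zero_left zero_neq_one)
  have torus: "(s, p) \<in> sym_torus"
    using sym_torusI[of s p] x sp p 0(1) by simp
  have "norm (peak_factor s0 p0 x) \<ge> 16"
    using prod mult_right_mono[OF le2, of "norm (peak_factor s0 p0 x)"] by simp
  then have "(norm (s - s0))\<^sup>2 \<le> 0"
    using norm_peak_factor_sym_torus[OF sp0 torus] sp by simp
  then show ?thesis using sp p by simp
qed

text \<open>The peak function reaches 32 at \<open>x0\<close>, so a maximum point inside
  \<open>C\<close> has value at least 32 and must be \<open>x0\<close> itself.\<close>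

lemma sym_torus_subset_boundary:
  assumes C: "is_boundary sym_bidisc C"
  shows "sym_torus \<subseteq> C"
proof
  fix x0 assume "x0 \<in> sym_torus"
  then obtain s0 p0 where sp0: "x0 = (s0, p0)" "(s0, p0) \<in> sym_torus" by (cases x0) auto
  let ?f = "\<lambda>x. (1 + cnj p0 * snd x) * peak_factor s0 p0 x"
  have "\<exists>x\<in>C. \<forall>y\<in>Gamma2. norm (?f y) \<le> norm (?f x)"
    by (rule bspec[OF conjunct2[OF C[unfolded is_boundary_def closure_sym_bidisc]]
          peak_in_holo_algebra])
  then obtain x where x: "x \<in> C" "\<forall>y\<in>Gamma2. norm (?f y) \<le> norm (?f x)" by blast
  have "norm (?f x0) = 32"
    using norm_peak_factor_sym_torus[OF sp0(2) sp0(2)] sym_torusD(2)[OF sp0(2)] sp0(1)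
    by (simp add: norm_mult)
  then have "norm (?f x) \<ge> 32"
    using x(2) sp0 sym_torus_subset_Gamma2 by (metis subsetD)
  moreover have "x \<in> Gamma2" using C x(1) by (auto simp: is_boundary_def closure_sym_bidisc)
  ultimately show "x0 \<in> C" using peak_unique[OF sp0(2)] x(1) sp0(1) by simp
qed

lemma distinguished_boundary_sym_bidisc: "distinguished_boundary sym_bidisc = sym_torus"
  unfolding distinguished_boundary_def
  by (rule Least_equality)
     (use compact_imp_closed[OF compact_sym_torus] is_boundary_sym_torus
        sym_torus_subset_boundary in auto)

section \<open>Automorphisms of the disc\<close>

lemma blaschke_eq_Moebius_function: "blaschke \<alpha> z = - Moebius_function 0 \<alpha> z"
  unfolding blaschke_def Moebius_function_simple
  by (metis minus_diff_eq minus_divide_right)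

lemma norm_blaschke_less_1: "norm \<alpha> < 1 \<Longrightarrow> norm z < 1 \<Longrightarrow> norm (blaschke \<alpha> z) < 1"
  by (simp add: blaschke_eq_Moebius_function Moebius_function_norm_lt_1)

lemma holomorphic_on_blaschke: "norm \<alpha> < 1 \<Longrightarrow> blaschke \<alpha> holomorphic_on ball 0 1"
  unfolding blaschke_eq_Moebius_function[abs_def]
  by (intro holomorphic_intros Moebius_function_holomorphic)

text \<open>The sign in \<open>blaschke\<close> makes it an involution: the inner minus sign turns
  the outer map into the Moebius map with parameter \<open>- \<alpha>\<close>, which inverts the one
  with parameter \<alpha>.\<close>

lemma blaschke_blaschke:
  assumes "norm \<alpha> < 1" "norm z < 1"
  shows "blaschke \<alpha> (blaschke \<alpha> z) = z"
proof -
  have "blaschke \<alpha> (- u) = Moebius_function 0 (- \<alpha>) u" for u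
    unfolding blaschke_def Moebius_function_simple
    by (subst minus_divide_divide[symmetric]) (simp add: algebra_simps)
  then show ?thesis
    using Moebius_function_compose[of "- \<alpha>" \<alpha> z] assms
    by (simp add: blaschke_eq_Moebius_function[of \<alpha> z])
qed

text \<open>On the circle the denominator is -z times the conjugate of the numerator.\<close>

lemma norm_blaschke_eq_1:
  assumes "norm \<alpha> < 1" "norm z = 1"
  shows "norm (blaschke \<alpha> z) = 1"
proof -
  have "cnj z * z = 1"
    using assms by (metis complex_norm_square mult.commute of_real_1 power_one)
  then have "cnj \<alpha> * z - 1 = - (z * cnj (z - \<alpha>))"
    by (simp add: algebra_simps)
  then have "norm (cnj \<alpha> * z - 1) = norm (z - \<alpha>)"
    using assms by (metis complex_mod_cnj mult_1 norm_minus_cancel norm_mult)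
  moreover have "z \<noteq> \<alpha>" using assms by auto
  ultimately show ?thesis by (simp add: blaschke_def norm_divide)
qed

text \<open>The involution identity covers only the open disc. Here cross-multiplying the equation
  factors it as (z - w)(|\<alpha>|^2 - 1) = 0.\<close>

lemma inj_on_blaschke_cball:
  assumes "norm \<alpha> < 1"
  shows "inj_on (blaschke \<alpha>) (cball 0 1)"
proof (rule inj_onI)
  fix z w :: complex
  assume zw: "z \<in> cball 0 1" "w \<in> cball 0 1" and eq: "blaschke \<alpha> z = blaschke \<alpha> w"
  have nz: "cnj \<alpha> * u - 1 \<noteq> 0" if "norm u \<le> 1" for u
  proof
    assume "cnj \<alpha> * u - 1 = 0"
    then have "norm \<alpha> * norm u = 1" by (metis complex_mod_cnj eq_iff_diff_eq_0 norm_mult norm_one)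
    then show False using assms that mult_left_le[of "norm u" "norm \<alpha>"] by simp
  qed
  have "(z - \<alpha>) * (cnj \<alpha> * w - 1) = (w - \<alpha>) * (cnj \<alpha> * z - 1)"
    using eq nz[of z] nz[of w] zw by (simp add: blaschke_def frac_eq_eq)
  then have "(z - w) * (\<alpha> * cnj \<alpha> - 1) = 0" by (simp add: algebra_simps)
  moreover have "\<alpha> * cnj \<alpha> \<noteq> 1"
  proof
    assume "\<alpha> * cnj \<alpha> = 1"
    then have "norm \<alpha> * norm \<alpha> = 1" by (metis complex_mod_cnj norm_mult norm_one)
    then show False using assms by (metis norm_mult norm_mult_less less_irrefl mult_1)
  qed
  ultimately show "z = w" by simp
qed

text \<open>Since the Blaschke factor is an involution, the inverse is \<open>?g\<close>: undo the
  rotation, then apply the same factor.\<close>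

lemma blaschke_in_Aut_disc:
  assumes "norm \<omega> = 1" "norm \<alpha> < 1"
  shows "(\<lambda>z. \<omega> * blaschke \<alpha> z) \<in> Aut_disc"
proof -
  let ?v = "\<lambda>z. \<omega> * blaschke \<alpha> z" and ?g = "\<lambda>z. blaschke \<alpha> (z / \<omega>)"
  have w0: "\<omega> \<noteq> 0" using assms(1) by auto
  have bij: "bij_betw ?v (ball 0 1) (ball 0 1)"
    by (rule bij_betw_byWitness[where f' = ?g])
       (use assms w0 in \<open>auto simp: blaschke_blaschke norm_blaschke_less_1 norm_mult norm_divide\<close>)
  have "(\<lambda>z. z / \<omega>) holomorphic_on ball 0 1"
    using w0 by (intro holomorphic_intros) auto
  from holomorphic_on_compose_gen[OF this holomorphic_on_blaschke[OF assms(2)]]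
  have "?g holomorphic_on ball 0 1"
    using assms by (auto simp: o_def norm_divide image_subset_iff)
  moreover have "?g z = inv_into (ball 0 1) ?v z" if "z \<in> ball 0 1" for z
    using that assms w0
    by (intro inv_into_f_eq[symmetric] bij_betw_imp_inj_on[OF bij])
       (auto simp: blaschke_blaschke norm_blaschke_less_1 norm_divide)
  ultimately have "inv_into (ball 0 1) ?v holomorphic_on ball 0 1"
    by (rule holomorphic_transform)
  then show ?thesis
    using bij holomorphic_on_blaschke[OF assms(2)]
    by (auto simp: Aut_disc_def intro!: holomorphic_intros)
qed

text \<open>Precomposing \<open>v\<close> with the Blaschke factor at its zero gives
  \<open>h\<close> fixing 0, with inverse \<open>k\<close>. Schwarz for both yields equality at a
  point, so \<open>h\<close> is a rotation; the involution then recovers \<open>v\<close>.\<close>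

lemma Aut_disc_eq_blaschke:
  assumes "v \<in> Aut_disc"
  obtains \<omega> \<alpha> where "norm \<omega> = 1" "norm \<alpha> < 1" "\<And>u. u \<in> ball 0 1 \<Longrightarrow> v u = \<omega> * blaschke \<alpha> u"
proof -
  let ?B = "ball (0::complex) 1"
  define g where "g = inv_into ?B v"
  have hv: "v holomorphic_on ?B" and hg: "g holomorphic_on ?B" and bij: "bij_betw v ?B ?B"
    using assms by (auto simp: Aut_disc_def g_def)
  have vB: "norm (v z) < 1" if "norm z < 1" for z
    using bij_betwE[OF bij] that by auto
  have gB: "norm (g z) < 1" if "norm z < 1" for z
    using bij_betwE[OF bij_betw_inv_into[OF bij]] that by (auto simp: g_def)
  have gv: "g (v z) = z" if "norm z < 1" for z
    using bij_betw_inv_into_left[OF bij] that by (auto simp: g_def)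
  have vg: "v (g z) = z" if "norm z < 1" for z
    using bij_betw_inv_into_right[OF bij] that by (auto simp: g_def)
  define \<alpha> where "\<alpha> = g 0"
  have a: "norm \<alpha> < 1" "v \<alpha> = 0" "g 0 = \<alpha>" using gB vg by (auto simp: \<alpha>_def)
  note B = norm_blaschke_less_1[OF a(1)] and hB = holomorphic_on_blaschke[OF a(1)]
  have "blaschke \<alpha> 0 = \<alpha>" "blaschke \<alpha> \<alpha> = 0" by (auto simp: blaschke_def)
  note 0 = this
  define h where "h = (\<lambda>z. v (blaschke \<alpha> z))"
  define k where "k = (\<lambda>z. blaschke \<alpha> (g z))"
  have hh: "h holomorphic_on ?B" "h 0 = 0" "\<And>z. norm z < 1 \<Longrightarrow> norm (h z) < 1"
    using holomorphic_on_compose_gen[OF hB hv] B vB 0 a by (auto simp: h_def o_def image_subset_iff)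
  have hk: "k holomorphic_on ?B" "k 0 = 0" "\<And>z. norm z < 1 \<Longrightarrow> norm (k z) < 1"
    using holomorphic_on_compose_gen[OF hg hB] B gB 0 a by (auto simp: k_def o_def image_subset_iff)
  \<comment> \<open>Equality in Schwarz's lemma is needed at a single nonzero point; 1/2 serves as
    that point.\<close>
  have half: "norm (1/2 :: complex) < 1" by simp
  have kh: "k (h (1/2)) = 1/2"
    using half by (simp add: h_def k_def gv B blaschke_blaschke a(1))
  have "norm (1/2 :: complex) \<le> norm (h (1/2))"
    using Schwarz_Lemma(1)[OF hk hh(3)[OF half]] by (simp only: kh)
  moreover have "norm (h (1/2)) \<le> norm (1/2 :: complex)"
    by (rule Schwarz_Lemma(1)[OF hh half])
  ultimately have "norm (1/2 :: complex) < 1 \<and> (1/2 :: complex) \<noteq> 0 \<and> norm (h (1/2)) = norm (1/2 :: complex)"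
    by simp
  then obtain \<omega> where w: "\<forall>z. norm z < 1 \<longrightarrow> h z = \<omega> * z" "norm \<omega> = 1"
    using Schwarz_Lemma(3)[OF hh half] by blast
  have "v u = \<omega> * blaschke \<alpha> u" if "u \<in> ?B" for u
  proof -
    have "h (blaschke \<alpha> u) = \<omega> * blaschke \<alpha> u" using w(1) B that by simp
    then show ?thesis using that by (simp add: h_def blaschke_blaschke a(1))
  qed
  with w(2) a(1) that show ?thesis by blast
qed

lemma norm_aut_ext_eq_1:
  assumes "v \<in> Aut_disc" "norm z = 1"
  shows "norm (aut_ext v z) = 1"
proof -
  obtain \<omega> \<alpha> where w: "norm \<omega> = 1" "norm \<alpha> < 1" "\<And>u. u \<in> ball 0 1 \<Longrightarrow> v u = \<omega> * blaschke \<alpha> u"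
    using Aut_disc_eq_blaschke[OF assms(1)] by metis
  then show ?thesis
    using aut_ext_eq[OF w] norm_blaschke_eq_1[OF w(2) assms(2)] by (simp add: norm_mult)
qed

lemma inj_on_aut_ext_cball:
  assumes "v \<in> Aut_disc"
  shows "inj_on (aut_ext v) (cball 0 1)"
proof -
  obtain \<omega> \<alpha> where w: "norm \<omega> = 1" "norm \<alpha> < 1" "\<And>u. u \<in> ball 0 1 \<Longrightarrow> v u = \<omega> * blaschke \<alpha> u"
    using Aut_disc_eq_blaschke[OF assms] by metis
  have "\<omega> \<noteq> 0" using w(1) by auto
  then show ?thesis
    using inj_on_blaschke_cball[OF w(2)] aut_ext_eq[OF w] by (simp add: inj_on_def)
qed

section \<open>Moving points and pairs of points on the circle\<close>

lemma Aut_disc_transitive_circle: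
  assumes "norm a = 1"
  obtains v where "v \<in> Aut_disc" "aut_ext v 1 = a"
proof
  \<comment> \<open>Because \<open>blaschke 0 z = - z\<close>, the coefficient \<open>- a\<close>
    produces the rotation by \<open>a\<close>.\<close>
  show "(\<lambda>z. (- a) * blaschke 0 z) \<in> Aut_disc"
    by (rule blaschke_in_Aut_disc) (use assms in auto)
  show "aut_ext (\<lambda>z. (- a) * blaschke 0 z) 1 = a"
    by (subst aut_ext_eq[of "- a" 0]) (use assms in \<open>auto simp: blaschke_def\<close>)
qed

text \<open>For real \<open>t\<close> the factor satisfies
  \<open>blaschke t (-\<i>) = cnj (blaschke t \<i>)\<close>, and solving \<open>blaschke t \<i> = u\<close>
  for \<open>t\<close> gives \<open>t = Re u / (1 - Im u)\<close>.\<close>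

lemma blaschke_real_imaginary_unit:
  assumes u: "norm u = 1" and Im: "Im u < 0"
  obtains \<alpha> where "norm \<alpha> < 1" "blaschke \<alpha> \<i> = u" "blaschke \<alpha> (- \<i>) = cnj u"
proof -
  define t where "t = Re u / (1 - Im u)"
  have sq: "(Re u)\<^sup>2 + (Im u)\<^sup>2 = 1" using u by (metis cmod_power2 power_one)
  \<comment> \<open>The sign of Im u enters here: |Re u| \<le> 1 < 1 - Im u places \<open>t\<close>
    in the disc.\<close>
  have "\<bar>Re u\<bar> < 1 - Im u" using u Im abs_Re_le_cmod[of u] by linarith
  then have t1: "\<bar>t\<bar> < 1" using Im by (simp add: t_def abs_divide)
  have ti: "t * (1 - Im u) = Re u" using Im by (simp add: t_def)
  have tr: "t * Re u = 1 + Im u"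
  proof -
    have "(1 - Im u) * (t * Re u) = (t * (1 - Im u)) * Re u" by (simp add: algebra_simps)
    also have "\<dots> = (1 - Im u) * (1 + Im u)"
      unfolding ti using sq by (simp add: algebra_simps power2_eq_square)
    finally show ?thesis using Im by simp
  qed
  have nz: "of_real t * \<i> - 1 \<noteq> 0" "- (of_real t * \<i>) - 1 \<noteq> 0"
    by (auto simp: complex_eq_iff)
  have "u * (of_real t * \<i> - 1) = \<i> - of_real t"
    \<comment> \<open>\<open>ti\<close> is the real part of this equation and \<open>tr\<close> its
      imaginary part.\<close>
    using ti tr by (simp add: complex_eq_iff algebra_simps)
  moreover have "cnj u * (- (of_real t * \<i>) - 1) = - \<i> - of_real t"
    using ti tr by (simp add: complex_eq_iff algebra_simps)
  ultimately have "blaschke (of_real t) \<i> = u" "blaschke (of_real t) (- \<i>) = cnj u"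
    using nz by (simp_all add: blaschke_def divide_eq_eq)
  moreover have "norm (complex_of_real t) < 1" using t1 by simp
  ultimately show ?thesis using that by blast
qed

text \<open>A rotation by \<omega> after the real Blaschke factor sends the pair to \<omega> u and
  \<open>\<omega> * cnj u\<close>. Matching these with a and b requires u^2 = a/b and \<omega> =
  \<open>a * cnj u\<close>.\<close>

lemma Aut_disc_distinct_pair:
  assumes a: "norm a = 1" and b: "norm b = 1" and "a \<noteq> b"
  obtains v where "v \<in> Aut_disc" "aut_ext v \<i> = a" "aut_ext v (- \<i>) = b"
proof -
  define c where "c = csqrt (a / b)"
  \<comment> \<open>Either square root would match the quotient; the one in the lower half-plane
    makes the real parameter lie in the disc.\<close>
  define u where "u = (if Im c < 0 then c else - c)"
  have b0: "b \<noteq> 0" using b by auto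
  have u2: "u\<^sup>2 = a / b" by (simp add: u_def c_def)
  then have "(norm u)\<^sup>2 = 1" using a b by (metis div_by_1 norm_divide norm_power)
  then have u: "norm u = 1" by (metis norm_ge_zero power2_eq_1_iff neg_0_le_iff_le not_one_le_zero)
  then have uu: "u * cnj u = 1" by (metis complex_norm_square of_real_1 power_one)
  \<comment> \<open>A real unimodular root has square 1, which contradicts the distinctness of
    \<open>a\<close> and \<open>b\<close>.\<close>
  have "Im u \<noteq> 0"
  proof
    assume "Im u = 0"
    then have "cnj u = u" by (simp add: complex_eq_iff)
    then have "a / b = 1" using uu u2 by (simp add: power2_eq_square)
    then show False using assms(3) b0 by simp
  qed
  then have "Im u < 0" by (auto simp: u_def split: if_splits)
  then obtain \<alpha> where al: "norm \<alpha> < 1" "blaschke \<alpha> \<i> = u" "blaschke \<alpha> (- \<i>) = cnj u"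
    using blaschke_real_imaginary_unit[OF u] by metis
  have w: "norm (a * cnj u) = 1" using a u by (simp add: norm_mult)
  show ?thesis
  proof
    show "(\<lambda>z. a * cnj u * blaschke \<alpha> z) \<in> Aut_disc" by (rule blaschke_in_Aut_disc[OF w al(1)])
    have ext: "aut_ext (\<lambda>z. a * cnj u * blaschke \<alpha> z) z = a * cnj u * blaschke \<alpha> z" for z
      by (rule aut_ext_eq[OF w al(1)]) simp
    show "aut_ext (\<lambda>z. a * cnj u * blaschke \<alpha> z) \<i> = a"
      unfolding ext al using uu by (simp add: mult.assoc mult.commute[of "cnj u" u])
    have "a = b * u\<^sup>2" using u2 b0 by simp
    then have "a * cnj u * cnj u = b * (u * cnj u)\<^sup>2"
      by (simp add: power2_eq_square algebra_simps)
    then show "aut_ext (\<lambda>z. a * cnj u * blaschke \<alpha> z) (- \<i>) = b"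
      unfolding ext al uu by simp
  qed
qed

section \<open>The two orbits\<close>

text \<open>The discriminant s^2 - 4p is (a - b)^2.\<close>

lemma symmetrize_in_royal_variety_iff:
  assumes "norm a \<le> 1" "norm b \<le> 1"
  shows "symmetrize a b \<in> royal_variety \<longleftrightarrow> a = b"
proof -
  have "(a + b)\<^sup>2 = 4 * (a * b) \<longleftrightarrow> (a - b)\<^sup>2 = 0"
    by (auto simp: power2_eq_square algebra_simps)
  then show ?thesis
    using symmetrize_in_Gamma2[OF assms] by (auto simp: royal_variety_def symmetrize_def)
qed

lemma orbit_2_1: "{tau v (2, 1) | v. v \<in> Aut_disc} = sym_torus \<inter> royal_variety"
proof -
  have "tau v (2, 1) = symmetrize (aut_ext v 1) (aut_ext v 1)" for v
    using tau_symmetrize[of 1 1 v] by (simp add: symmetrize_def)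
  then have "{tau v (2, 1) | v. v \<in> Aut_disc} = {symmetrize a a | a. norm a = 1}"
    using norm_aut_ext_eq_1[OF _ norm_one] Aut_disc_transitive_circle
    by (auto, metis)
  also have "\<dots> = sym_torus \<inter> royal_variety"
    by (force simp: sym_torus_def symmetrize_in_royal_variety_iff)
  finally show ?thesis .
qed

lemma orbit_0_1: "{tau v (0, 1) | v. v \<in> Aut_disc} = sym_torus - royal_variety"
proof -
  have tau: "tau v (0, 1) = symmetrize (aut_ext v \<i>) (aut_ext v (- \<i>))" for v
    using tau_symmetrize[of \<i> "- \<i>" v] by (simp add: symmetrize_def)
  \<comment> \<open>Injectivity up to the boundary keeps the image pair off the diagonal, hence off
    the royal variety.\<close>
  have "aut_ext v \<i> \<noteq> aut_ext v (- \<i>)" if "v \<in> Aut_disc" for v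
    using inj_onD[OF inj_on_aut_ext_cball[OF that], of \<i> "- \<i>"] by (auto simp: complex_eq_iff)
  then have "{tau v (0, 1) | v. v \<in> Aut_disc} = {symmetrize a b | a b. norm a = 1 \<and> norm b = 1 \<and> a \<noteq> b}"
    unfolding tau
    using norm_aut_ext_eq_1[of _ \<i>] norm_aut_ext_eq_1[of _ "- \<i>"] Aut_disc_distinct_pair
    by (auto, blast, metis)
  also have "\<dots> = sym_torus - royal_variety"
    by (force simp: sym_torus_def symmetrize_in_royal_variety_iff)
  finally show ?thesis .
qed

theorem theorem2p4:
  "distinguished_boundary sym_bidisc
     = {tau v (0, 1) | v. v \<in> Aut_disc} \<union> {tau v (2, 1) | v. v \<in> Aut_disc} \<and>
   distinguished_boundary sym_bidisc \<inter> royal_variety = {tau v (2, 1) | v. v \<in> Aut_disc} \<and>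
   distinguished_boundary sym_bidisc - royal_variety = {tau v (0, 1) | v. v \<in> Aut_disc}"
  unfolding distinguished_boundary_sym_bidisc orbit_2_1 orbit_0_1 by blast

end
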